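(* There exists a stationary generalized Bratteli diagram together with a (non-stationary) order such that the set $X_{\min}$ of infinite minimal paths has the cardinality of the continuum and the set $X_{\max}$ of infinite maximal paths is countably infinite.
   Context: A generalized Bratteli diagram is an infinite graded graph $B=(V,E)$ with $V=\bigsqcup_{n\ge0}V_n$, $E=\bigsqcup_{n\ge0}E_n$, with range and source maps $r,s$ satisfying $r(E_n)=V_{n+1}$, $s(E_n)=V_n$, such that each $V_n$ is countably infinite, each $E_n$ is countable, and $|r^{-1}(v)|<\infty$ for every $v\in V\setminus V_0$. Its $n$-th incidence matrix $F_n=(f^{(n)}_{v,w})$, $v\in V_{n+1}$, $w\in V_n$, counts the edges from $w$ to $v$; the diagram is stationary if all the sets $V_n$ are identified with one index set and $F_n=F$ for all $n$. An order on $B$ is a partial order on $E$ in which edges $e,e'$ are comparable if and only if $r(e)=r(e')$, i.e. a linear order on each finite set $r^{-1}(v)$, $v\in V\setminus V_0$. An order on a stationary diagram is stationary if for each index $v$ the linearly ordered list of sources of the edges in $r^{-1}(v)$, $v\in V_{n+1}$, is the same for all $n\ge0$, and non-stationary otherwise. An infinite path $(e_0,e_1,\dots)$ starting at $V_0$ is minimal (respectively maximal) if each $e_n$ is minimal (respectively maximal) in $r^{-1}(r(e_n))$. *)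

theory Defs
  imports Complex_Main "HOL-Library.Equipollence" "HOL-Library.Countable_Set"
    "HOL-Library.Disjoint_Sets"
begin

record ('v, 'e) diagram =
  vertices :: "nat \<Rightarrow> 'v set"
  edges :: "nat \<Rightarrow> 'e set"
  source :: "'e \<Rightarrow> 'v"
  range_of :: "'e \<Rightarrow> 'v"

definition all_edges :: "('v, 'e) diagram \<Rightarrow> 'e set"
  where "all_edges B = (\<Union>n. edges B n)"

definition in_edges :: "('v, 'e) diagram \<Rightarrow> 'v \<Rightarrow> 'e set"
  where "in_edges B v = {e \<in> all_edges B. range_of B e = v}"

definition generalized_bratteli :: "('v, 'e) diagram \<Rightarrow> bool"
  where "generalized_bratteli B \<longleftrightarrow>
    disjoint_family (vertices B) \<and>
    disjoint_family (edges B) \<and>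
    (\<forall>n. range_of B ` edges B n = vertices B (Suc n)) \<and>
    (\<forall>n. source B ` edges B n = vertices B n) \<and>
    (\<forall>n. countable (vertices B n) \<and> infinite (vertices B n)) \<and>
    (\<forall>n. countable (edges B n)) \<and>
    (\<forall>n. \<forall>v \<in> vertices B (Suc n). finite (in_edges B v))"

text \<open>Entry \<open>(v, w)\<close> of the \<open>n\<close>-th incidence matrix. The set is finite for \<open>v\<close> in level
  \<open>Suc n\<close> of a generalized Bratteli diagram, so \<open>card\<close> is the true number of edges.\<close>

definition incidence :: "('v, 'e) diagram \<Rightarrow> nat \<Rightarrow> 'v \<Rightarrow> 'v \<Rightarrow> nat"
  where "incidence B n v w = card {e \<in> edges B n. source B e = w \<and> range_of B e = v}"

text \<open>The identification of all levels with one index set \<open>I\<close> is explicit data: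
  \<open>\<iota> n i\<close> is the vertex of level \<open>n\<close> with index \<open>i\<close>.\<close>

definition stationary_diagram ::
    "('v, 'e) diagram \<Rightarrow> 'i set \<Rightarrow> (nat \<Rightarrow> 'i \<Rightarrow> 'v) \<Rightarrow> bool"
  where "stationary_diagram B I \<iota> \<longleftrightarrow>
    generalized_bratteli B \<and>
    (\<forall>n. bij_betw (\<iota> n) I (vertices B n)) \<and>
    (\<exists>F :: 'i \<Rightarrow> 'i \<Rightarrow> nat. \<forall>n. \<forall>i \<in> I. \<forall>j \<in> I.
      incidence B n (\<iota> (Suc n) i) (\<iota> n j) = F i j)"

text \<open>\<open>(e, e') \<in> le\<close> means that \<open>e\<close> is below or equal to \<open>e'\<close>.\<close>

definition diagram_order :: "('v, 'e) diagram \<Rightarrow> 'e rel \<Rightarrow> bool"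
  where "diagram_order B le \<longleftrightarrow>
    partial_order_on (all_edges B) le \<and>
    (\<forall>e \<in> all_edges B. \<forall>e' \<in> all_edges B.
      ((e, e') \<in> le \<or> (e', e) \<in> le) \<longleftrightarrow> range_of B e = range_of B e')"

definition ordered_in_edges :: "('v, 'e) diagram \<Rightarrow> 'e rel \<Rightarrow> 'v \<Rightarrow> 'e list"
  where "ordered_in_edges B le v =
    (THE es. set es = in_edges B v \<and> distinct es \<and> sorted_wrt (\<lambda>e e'. (e, e') \<in> le) es)"

lemma ordered_in_edges_ex1:
  assumes B: "generalized_bratteli B" and le: "diagram_order B le"
    and v: "v \<in> vertices B (Suc n)"
  shows "\<exists>!es. set es = in_edges B v \<and> distinct es \<and> sorted_wrt (\<lambda>e e'. (e, e') \<in> le) es"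
proof -
  have total: "(e, e') \<in> le \<or> (e', e) \<in> le" if "e \<in> in_edges B v" "e' \<in> in_edges B v" for e e'
    using le that unfolding diagram_order_def in_edges_def by auto
  have trans: "(a, c) \<in> le" if "(a, b) \<in> le" "(b, c) \<in> le" for a b c
    using le that unfolding diagram_order_def order_on_defs by (meson transD)
  have antisym: "a = b" if "(a, b) \<in> le" "(b, a) \<in> le" for a b
    using le that unfolding diagram_order_def order_on_defs by (meson antisymD)
  have fin: "finite (in_edges B v)"
    using B v unfolding generalized_bratteli_def by blast
  have ex1: "\<exists>!es. set es = A \<and> distinct es \<and> sorted_wrt (\<lambda>e e'. (e, e') \<in> le) es"
    if "finite A" "A \<subseteq> in_edges B v" for A
    using that
  proof (induction "card A" arbitrary: A)
    case 0
    then show ?case by auto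
  next
    case (Suc k)
    have "\<exists>m \<in> A. \<forall>a \<in> A. (m, a) \<in> le"
    proof -
      have "A \<noteq> {}" using Suc.hyps(2) by auto
      with Suc.prems(1) show ?thesis using Suc.prems(2)
      proof (induction A rule: finite_ne_induct)
        case (singleton x)
        then show ?case using total[of x x] by auto
      next
        case (insert x S)
        then obtain m where m: "m \<in> S" "\<forall>a \<in> S. (m, a) \<in> le" by auto
        consider "(m, x) \<in> le" | "(x, m) \<in> le"
          using total[of x m] insert.prems m(1) by auto
        then show ?case
        proof cases
          case 1
          then show ?thesis using m by blast
        next
          case 2
          have "(x, x) \<in> le" using total[of x x] insert.prems by auto
          then have "\<forall>a \<in> insert x S. (x, a) \<in> le" using m(2) trans[OF 2] by auto
          then show ?thesis by auto
        qed
      qed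
    qed
    then obtain m where m: "m \<in> A" "\<forall>a \<in> A. (m, a) \<in> le" by blast
    have "\<exists>!es. set es = A - {m} \<and> distinct es \<and> sorted_wrt (\<lambda>e e'. (e, e') \<in> le) es"
    proof (rule Suc.hyps(1))
      show "k = card (A - {m})" using Suc.hyps(2) Suc.prems(1) m(1) by simp
      show "finite (A - {m})" "A - {m} \<subseteq> in_edges B v" using Suc.prems by auto
    qed
    then obtain es where es: "set es = A - {m}" "distinct es" "sorted_wrt (\<lambda>e e'. (e, e') \<in> le) es"
      and uniq: "\<And>fs. set fs = A - {m} \<Longrightarrow> distinct fs \<Longrightarrow>
        sorted_wrt (\<lambda>e e'. (e, e') \<in> le) fs \<Longrightarrow> fs = es"
      by (elim ex1E) blast
    show ?case
    proof (rule ex1I[of _ "m # es"])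
      show "set (m # es) = A \<and> distinct (m # es) \<and> sorted_wrt (\<lambda>e e'. (e, e') \<in> le) (m # es)"
        using es m by auto
    next
      fix fs
      assume fs: "set fs = A \<and> distinct fs \<and> sorted_wrt (\<lambda>e e'. (e, e') \<in> le) fs"
      then obtain x xs where x: "fs = x # xs" using m(1) by (cases fs) auto
      have "x = m"
      proof (rule ccontr)
        assume "x \<noteq> m"
        then have "(x, m) \<in> le" using fs x m(1) by auto
        moreover have "(m, x) \<in> le" using fs x m(2) by auto
        ultimately show False using antisym[of x m] \<open>x \<noteq> m\<close> by simp
      qed
      then show "fs = m # es" using uniq[of xs] fs x by auto
    qed
  qed
  show ?thesis using ex1[OF fin] by simp
qed

text \<open>The sources of the edges entering \<open>\<iota> (Suc n) i\<close>, listed along the order as indices in \<open>I\<close>.\<close>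

definition source_list ::
    "('v, 'e) diagram \<Rightarrow> 'i set \<Rightarrow> (nat \<Rightarrow> 'i \<Rightarrow> 'v) \<Rightarrow> 'e rel \<Rightarrow> nat \<Rightarrow> 'i \<Rightarrow> 'i list"
  where "source_list B I \<iota> le n i =
    map (\<lambda>e. inv_into I (\<iota> n) (source B e)) (ordered_in_edges B le (\<iota> (Suc n) i))"

definition stationary_order ::
    "('v, 'e) diagram \<Rightarrow> 'i set \<Rightarrow> (nat \<Rightarrow> 'i \<Rightarrow> 'v) \<Rightarrow> 'e rel \<Rightarrow> bool"
  where "stationary_order B I \<iota> le \<longleftrightarrow>
    (\<forall>i \<in> I. \<forall>m n. source_list B I \<iota> le m i = source_list B I \<iota> le n i)"

definition infinite_paths :: "('v, 'e) diagram \<Rightarrow> (nat \<Rightarrow> 'e) set"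
  where "infinite_paths B =
    {p. (\<forall>n. p n \<in> edges B n) \<and> (\<forall>n. range_of B (p n) = source B (p (Suc n)))}"

definition minimal_edge :: "('v, 'e) diagram \<Rightarrow> 'e rel \<Rightarrow> 'e \<Rightarrow> bool"
  where "minimal_edge B le e \<longleftrightarrow>
    (\<forall>e' \<in> in_edges B (range_of B e). (e', e) \<in> le \<longrightarrow> e' = e)"

definition maximal_edge :: "('v, 'e) diagram \<Rightarrow> 'e rel \<Rightarrow> 'e \<Rightarrow> bool"
  where "maximal_edge B le e \<longleftrightarrow>
    (\<forall>e' \<in> in_edges B (range_of B e). (e, e') \<in> le \<longrightarrow> e' = e)"

definition X_min :: "('v, 'e) diagram \<Rightarrow> 'e rel \<Rightarrow> (nat \<Rightarrow> 'e) set"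
  where "X_min B le = {p \<in> infinite_paths B. \<forall>n. minimal_edge B le (p n)}"

definition X_max :: "('v, 'e) diagram \<Rightarrow> 'e rel \<Rightarrow> (nat \<Rightarrow> 'e) set"
  where "X_max B le = {p \<in> infinite_paths B. \<forall>n. maximal_edge B le (p n)}"

end

theory Submission
  imports Defs "HOL-Library.Nat_Bijection" "HOL-Analysis.Abstract_Topology_2"
begin

text \<open>
  Since every finite set \<open>r\<^sup>-\<^sup>1(v)\<close> has exactly one minimal edge, a minimal path read from right
  to left is forced: the vertex at level \<open>n + 1\<close> determines the vertex at level \<open>n\<close>. An infinite
  minimal path is therefore a branch of the forest given by the maps ``source of the minimal
  edge'', and likewise for maximal paths. On every level but 0, the diagram gives the vertex
  \<open>i\<close> two incoming edges, a halving edge from \<open>\<lfloor>i/2\<rfloor>\<close> and a vertical edge from \<open>i\<close>. The halving edges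
  form a forest in which every vertex has two successors, \<open>2i\<close> and \<open>2i + 1\<close>, and so it has
  continuum many branches. The vertical edges form countably many disjoint rays.

  Making halving edges minimal at all levels would give a stationary order. Hence the order is
  reversed on the first level, where vertical edges are minimal instead. A minimal
  or maximal path is determined by its tail from level 1 on, and every such tail extends to
  level 0 along the minimal or maximal edge, so the reversal does not change the cardinalities.

  Continuum many minimal paths come from an injection of the subsets of \<open>\<nat>\<close>, whose
  characteristic sequences choose between the two successors
  (\<open>nat_sets_lepoll_X_min_halving\<close>); conversely an infinite path is a function
  on \<open>\<nat>\<close> and is determined by its graph.
\<close>

section \<open>The halving diagram\<close>

text \<open>The pair \<open>(n, i)\<close> encodes the vertex \<open>i\<close> of level \<open>n\<close>. The pair \<open>(n, k)\<close> encodes an edge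
  into the vertex \<open>k div 2\<close> of level \<open>n + 1\<close>; it is the halving edge if \<open>k\<close> is even and the
  vertical edge if \<open>k\<close> is odd.\<close>

definition source_index :: "nat \<Rightarrow> nat"
  where "source_index k = (if even k then k div 2 div 2 else k div 2)"

definition halving_diagram :: "(nat, nat) diagram"
  where "halving_diagram = \<lparr>
    vertices = (\<lambda>n. range (\<lambda>i. prod_encode (n, i))),
    edges = (\<lambda>n. range (\<lambda>k. prod_encode (n, k))),
    source = (\<lambda>e. case prod_decode e of (n, k) \<Rightarrow> prod_encode (n, source_index k)),
    range_of = (\<lambda>e. case prod_decode e of (n, k) \<Rightarrow> prod_encode (Suc n, k div 2))\<rparr>"

definition halving_order :: "nat rel"
  where "halving_order = {(prod_encode (n, k), prod_encode (n, l)) |n k l.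
    k div 2 = l div 2 \<and> (if n = 0 then l \<le> k else k \<le> l)}"

lemma halving_diagram_simps [simp]:
  "vertices halving_diagram n = range (\<lambda>i. prod_encode (n, i))"
  "edges halving_diagram n = range (\<lambda>k. prod_encode (n, k))"
  "source halving_diagram (prod_encode (n, k)) = prod_encode (n, source_index k)"
  "range_of halving_diagram (prod_encode (n, k)) = prod_encode (Suc n, k div 2)"
  by (simp_all add: halving_diagram_def)

lemma halving_order_iff [simp]:
  "(prod_encode (n, k), prod_encode (m, l)) \<in> halving_order \<longleftrightarrow>
    n = m \<and> k div 2 = l div 2 \<and> (if n = 0 then l \<le> k else k \<le> l)"
  by (auto simp: halving_order_def)

lemma all_edges_halving [simp]: "all_edges halving_diagram = UNIV"
proof -
  have "e \<in> all_edges halving_diagram" for e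
  proof (cases "prod_decode e")
    case (Pair n k)
    then have "e = prod_encode (n, k)"
      by (metis prod_decode_inverse)
    then show ?thesis by (auto simp: all_edges_def)
  qed
  then show ?thesis by blast
qed

lemma div2_eq_iff: "k div 2 = i \<longleftrightarrow> k = 2 * i \<or> k = Suc (2 * i)" for k i :: nat
  by presburger

lemma in_edges_halving:
  "in_edges halving_diagram (prod_encode (Suc n, i)) =
    {prod_encode (n, 2 * i), prod_encode (n, Suc (2 * i))}"
proof -
  have "range_of halving_diagram e = prod_encode (Suc n, i) \<longleftrightarrow>
      e \<in> {prod_encode (n, 2 * i), prod_encode (n, Suc (2 * i))}" for e
  proof (cases "prod_decode e")
    case (Pair m k)
    then have "e = prod_encode (m, k)"
      by (metis prod_decode_inverse)
    then show ?thesis by (auto simp: div2_eq_iff)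
  qed
  then show ?thesis by (auto simp: in_edges_def)
qed

lemma generalized_bratteli_halving: "generalized_bratteli halving_diagram"
  unfolding generalized_bratteli_def
proof (intro conjI allI ballI)
  fix n
  show "range_of halving_diagram ` edges halving_diagram n = vertices halving_diagram (Suc n)"
  proof -
    have "\<exists>k. i = k div 2" for i :: nat
      by (rule exI[of _ "2 * i"]) simp
    then show ?thesis by (auto simp: image_iff)
  qed
  show "source halving_diagram ` edges halving_diagram n = vertices halving_diagram n"
  proof -
    \<comment> \<open>the vertical edge leaving \<open>i\<close>\<close>
    have "\<exists>k. i = source_index k" for i
      by (rule exI[of _ "Suc (2 * i)"]) (simp add: source_index_def)
    then show ?thesis by (auto simp: image_iff)
  qed
  show "infinite (vertices halving_diagram n)"
    by (auto intro!: range_inj_infinite injI)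
  show "finite (in_edges halving_diagram v)" if "v \<in> vertices halving_diagram (Suc n)" for v
    using that by (auto simp: in_edges_halving)
qed (auto simp: disjoint_family_on_def)

lemma stationary_diagram_halving:
  "stationary_diagram halving_diagram UNIV (\<lambda>n i. prod_encode (n, i))"
  unfolding stationary_diagram_def
proof (intro conjI allI exI ballI)
  show "generalized_bratteli halving_diagram" by (rule generalized_bratteli_halving)
  show "bij_betw (\<lambda>i. prod_encode (n, i)) UNIV (vertices halving_diagram n)" for n
    by (auto simp: bij_betw_def inj_on_def)
  fix n i j
  have "{e \<in> edges halving_diagram n. source halving_diagram e = prod_encode (n, j) \<and>
      range_of halving_diagram e = prod_encode (Suc n, i)} =
      (\<lambda>k. prod_encode (n, k)) ` {k. source_index k = j \<and> k div 2 = i}"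
    by auto
  then show "incidence halving_diagram n (prod_encode (Suc n, i)) (prod_encode (n, j)) =
      card {k. source_index k = j \<and> k div 2 = i}"
    by (simp add: incidence_def card_image inj_on_def)
qed

section \<open>The order and its extremal edges\<close>

lemma diagram_order_halving: "diagram_order halving_diagram halving_order"
  unfolding diagram_order_def
proof (intro conjI ballI)
  show "partial_order_on (all_edges halving_diagram) halving_order"
    unfolding order_on_defs
  proof (intro conjI)
    show "refl_on (all_edges halving_diagram) halving_order"
    proof (rule refl_onI)
      show "(e, e) \<in> halving_order" for e
        by (metis halving_order_iff prod_decode_inverse order_refl surj_pair)
    qed
    show "trans halving_order"
      by (rule transI) (auto simp: halving_order_def split: if_splits)
    show "antisym halving_order"
      by (rule antisymI) (auto simp: halving_order_def split: if_splits)
  qed (auto simp: order_on_defs)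
  fix e e'
  obtain n k m l where "e = prod_encode (n, k)" "e' = prod_encode (m, l)"
    by (metis prod_decode_inverse surj_pair)
  then show "((e, e') \<in> halving_order \<or> (e', e) \<in> halving_order) \<longleftrightarrow>
      range_of halving_diagram e = range_of halving_diagram e'"
    by auto
qed

lemma minimal_edge_halving:
  "minimal_edge halving_diagram halving_order (prod_encode (n, k)) \<longleftrightarrow> (even k \<longleftrightarrow> 0 < n)"
  by (cases "even k") (auto simp: minimal_edge_def in_edges_halving elim!: evenE oddE)

lemma maximal_edge_halving:
  "maximal_edge halving_diagram halving_order (prod_encode (n, k)) \<longleftrightarrow> (even k \<longleftrightarrow> n = 0)"
  by (cases "even k") (auto simp: maximal_edge_def in_edges_halving elim!: evenE oddE)

lemma ordered_in_edges_halving: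
  "ordered_in_edges halving_diagram halving_order (prod_encode (Suc n, i)) =
    (if n = 0 then [prod_encode (n, Suc (2 * i)), prod_encode (n, 2 * i)]
     else [prod_encode (n, 2 * i), prod_encode (n, Suc (2 * i))])"
  unfolding ordered_in_edges_def
  by (rule the1_equality[OF ordered_in_edges_ex1[OF generalized_bratteli_halving
        diagram_order_halving, of _ n]])
    (auto simp: in_edges_halving)

text \<open>The vertex 1 distinguishes the levels, because its two incoming edges have
  the different sources 0 and 1. At the vertex 0 both edges come from 0.\<close>

lemma not_stationary_order_halving:
  "\<not> stationary_order halving_diagram UNIV (\<lambda>n i. prod_encode (n, i)) halving_order"
proof
  let ?L = "source_list halving_diagram UNIV (\<lambda>n i. prod_encode (n, i)) halving_order"
  assume "stationary_order halving_diagram UNIV (\<lambda>n i. prod_encode (n, i)) halving_order"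
  then have "?L 0 1 = ?L 1 1"
    unfolding stationary_order_def by blast
  moreover have "inv (\<lambda>i. prod_encode (n, i)) (prod_encode (n, j)) = j" for n j
    by (rule inv_f_f) (auto intro: injI)
  then have "?L 0 1 = [1, 0]" "?L 1 1 = [0, 1]"
    by (simp_all only: source_list_def ordered_in_edges_halving)
      (simp_all add: source_index_def)
  ultimately show False by simp
qed

section \<open>Minimal and maximal paths\<close>

lemma infinite_paths_halving:
  "p \<in> infinite_paths halving_diagram \<longleftrightarrow>
    (\<exists>k. p = (\<lambda>n. prod_encode (n, k n)) \<and> (\<forall>n. k n div 2 = source_index (k (Suc n))))"
proof
  assume p: "p \<in> infinite_paths halving_diagram"
  then have "\<forall>n. \<exists>k. p n = prod_encode (n, k)"
    by (auto simp: infinite_paths_def)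
  then obtain k where k: "p n = prod_encode (n, k n)" for n
    by metis
  moreover from p have "k n div 2 = source_index (k (Suc n))" for n
    by (simp add: infinite_paths_def k)
  ultimately show "\<exists>k. p = (\<lambda>n. prod_encode (n, k n)) \<and>
      (\<forall>n. k n div 2 = source_index (k (Suc n)))"
    by blast
qed (auto simp: infinite_paths_def)

lemma X_min_halving:
  "p \<in> X_min halving_diagram halving_order \<longleftrightarrow>
    (\<exists>k. p = (\<lambda>n. prod_encode (n, k n)) \<and> (\<forall>n. k n div 2 = source_index (k (Suc n))) \<and>
      (\<forall>n. even (k n) \<longleftrightarrow> 0 < n))"
  by (auto simp: X_min_def infinite_paths_halving minimal_edge_halving)

lemma X_max_halving:
  "p \<in> X_max halving_diagram halving_order \<longleftrightarrow>
    (\<exists>k. p = (\<lambda>n. prod_encode (n, k n)) \<and> (\<forall>n. k n div 2 = source_index (k (Suc n))) \<and>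
      (\<forall>n. even (k n) \<longleftrightarrow> n = 0))"
  by (auto simp: X_max_def infinite_paths_halving maximal_edge_halving)

text \<open>The index at level \<open>n + 1\<close> of the branch of the halving forest that follows \<open>A\<close>: its
  binary digits, the most significant first, are the first \<open>n\<close> values of the characteristic
  function of \<open>A\<close>.\<close>

fun branch :: "nat set \<Rightarrow> nat \<Rightarrow> nat"
  where
    "branch A 0 = 0"
  | "branch A (Suc n) = 2 * branch A n + (if n \<in> A then 1 else 0)"

lemma branch_inject:
  assumes "\<And>n. branch A n = branch A' n"
  shows "A = A'"
proof -
  have "n \<in> A \<longleftrightarrow> n \<in> A'" for n
    using assms[of n] assms[of "Suc n"] by (simp split: if_splits)
  then show ?thesis by blast
qed

lemma nat_sets_lepoll_X_min_halving:
  "(UNIV :: nat set set) \<lesssim> X_min halving_diagram halving_order"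
proof -
  \<comment> \<open>on level 0 the minimal edge is the vertical one, hence the odd number there\<close>
  define k where "k A n = 2 * branch A n + (if n = 0 then 1 else 0)" for A n
  define p where "p A = (\<lambda>n. prod_encode (n, k A n))" for A
  have "k A n div 2 = source_index (k A (Suc n))" for A n
    by (simp add: k_def source_index_def)
  moreover have "even (k A n) \<longleftrightarrow> 0 < n" for A n
    by (simp add: k_def)
  ultimately have "p A \<in> X_min halving_diagram halving_order" for A
    unfolding X_min_halving p_def by blast
  moreover have "inj p"
  proof (rule injI)
    fix A A' assume "p A = p A'"
    then have "k A n = k A' n" for n
      unfolding p_def by (metis prod_encode_eq prod.inject)
    then have "branch A n = branch A' n" for n
      by (simp add: k_def split: if_splits)
    then show "A = A'" by (rule branch_inject)
  qed
  ultimately show ?thesis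
    unfolding lepoll_def by blast
qed

lemma nat_functions_lepoll_nat_sets: "(S :: (nat \<Rightarrow> nat) set) \<lesssim> (UNIV :: nat set set)"
proof -
  define graph where "graph f = range (\<lambda>n. prod_encode (n, f n))" for f :: "nat \<Rightarrow> nat"
  have "inj_on graph S"
  proof (rule inj_onI, rule ext)
    fix f g n assume "graph f = graph g"
    then have "prod_encode (n, f n) \<in> graph g"
      unfolding graph_def by blast
    then show "f n = g n" by (auto simp: graph_def)
  qed
  then show ?thesis
    unfolding lepoll_def by blast
qed

lemma X_min_halving_eqpoll_reals: "X_min halving_diagram halving_order \<approx> (UNIV :: real set)"
  using lepoll_antisym[OF nat_functions_lepoll_nat_sets nat_sets_lepoll_X_min_halving]
    nat_sets_eqpoll_reals
  by (rule eqpoll_trans)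

text \<open>From level 1 on a maximal path follows vertical edges and stays at one index \<open>j\<close>; its
  first edge is the halving edge from \<open>\<lfloor>j/2\<rfloor>\<close> to \<open>j\<close>.\<close>

lemma X_max_halving_eq:
  "X_max halving_diagram halving_order =
    range (\<lambda>j n. prod_encode (n, 2 * j + (if n = 0 then 0 else 1)))"
proof (intro set_eqI iffI)
  fix p assume "p \<in> X_max halving_diagram halving_order"
  then obtain k where p: "p = (\<lambda>n. prod_encode (n, k n))"
    and step: "\<And>n. k n div 2 = source_index (k (Suc n))"
    and parity: "\<And>n. even (k n) \<longleftrightarrow> n = 0"
    unfolding X_max_halving by blast
  have const: "k n div 2 = k 0 div 2" for n
  proof (induction n)
    case (Suc n)
    then show ?case using step[of n] parity[of "Suc n"] by (simp add: source_index_def)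
  qed simp
  have k: "k n = 2 * (k 0 div 2) + (if n = 0 then 0 else 1)" for n
    using const[of n] parity[of n] by (auto elim!: evenE oddE)
  have "p = (\<lambda>n. prod_encode (n, 2 * (k 0 div 2) + (if n = 0 then 0 else 1)))"
    unfolding p by (rule ext, subst k, rule refl)
  then show "p \<in> range (\<lambda>j n. prod_encode (n, 2 * j + (if n = 0 then 0 else 1)))"
    by (rule range_eqI)
next
  fix p :: "nat \<Rightarrow> nat"
  assume "p \<in> range (\<lambda>j n. prod_encode (n, 2 * j + (if n = 0 then 0 else 1)))"
  then obtain j where "p = (\<lambda>n. prod_encode (n, 2 * j + (if n = 0 then 0 else 1)))"
    by blast
  then show "p \<in> X_max halving_diagram halving_order"
    unfolding X_max_halving
    by (intro exI[of _ "\<lambda>n. 2 * j + (if n = 0 then 0 else 1)"]) (simp add: source_index_def)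
qed

lemma countable_X_max_halving: "countable (X_max halving_diagram halving_order)"
  by (simp add: X_max_halving_eq)

lemma infinite_X_max_halving: "infinite (X_max halving_diagram halving_order)"
  unfolding X_max_halving_eq
proof (rule range_inj_infinite, rule injI)
  fix i j :: nat
  assume "(\<lambda>n. prod_encode (n, 2 * i + (if n = 0 then 0 else 1))) =
    (\<lambda>n. prod_encode (n, 2 * j + (if n = 0 then 0 else 1)))"
  from fun_cong[OF this, of 0] show "i = j" by simp
qed

theorem corollary5p5:
  shows "\<exists>(B :: (nat, nat) diagram) (I :: nat set) (\<iota> :: nat \<Rightarrow> nat \<Rightarrow> nat) (le :: nat rel).
    stationary_diagram B I \<iota> \<and>
    diagram_order B le \<and>
    \<not> stationary_order B I \<iota> le \<and>
    X_min B le \<approx> (UNIV :: real set) \<and>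
    countable (X_max B le) \<and> infinite (X_max B le)"
  using stationary_diagram_halving diagram_order_halving not_stationary_order_halving
    X_min_halving_eqpoll_reals countable_X_max_halving infinite_X_max_halving
  by blast

end
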